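(* There is a deterministic online exploration algorithm with advice that, for every tadpole graph $G$ on $n$ vertices with positive edge weights and every starting vertex $s$, given a suitable advice string of $\lceil \log_2 n\rceil+1$ bits, explores $G$ with cost exactly $\mathrm{cost}_{\mathrm{opt}}(G,s)$ (competitive ratio $1$).
   Context: A tadpole graph is a connected undirected graph consisting of a cycle (at least 3 vertices) together with a path (the stem, at least 1 vertex), one endpoint of which is joined by an edge to one cycle vertex (the junction); exactly one vertex has degree 1, exactly one has degree 3, others degree 2. Each edge $e$ has positive weight $c(e)$. Online exploration model: vertices have unique identifiers; a searcher starts at $s$ knowing only $s$; upon arriving at $v$ it learns identifiers of all neighbours of $v$ and weights of all incident edges; each edge traversal costs its weight; the searcher must perform a closed walk from $s$ visiting all vertices and returning to $s$. $\mathrm{cost}_{\mathrm{opt}}(G,s)$ is the minimum cost of such a closed walk. Advice model: before the exploration starts, an oracle that knows the entire graph, the starting vertex and the (deterministic) algorithm gives the searcher a bit string (the advice), which the algorithm may use in its decisions. *)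

theory Defs
  imports Complex_Main
begin

record 'v wgraph =
  verts :: "'v set"
  edges :: "'v set set"
  weight :: "'v set \<Rightarrow> real"

definition positive_weights :: "'v wgraph \<Rightarrow> bool" where
  "positive_weights G \<longleftrightarrow> (\<forall>e \<in> edges G. 0 < weight G e)"

definition path_edges :: "'v list \<Rightarrow> 'v set set" where
  "path_edges xs = {{xs ! i, xs ! Suc i} | i. Suc i < length xs}"

definition cycle_edges :: "'v list \<Rightarrow> 'v set set" where
  "cycle_edges xs = insert {last xs, hd xs} (path_edges xs)"

text \<open>The cycle is \<open>xs\<close>, the stem is \<open>ys\<close> (listed starting from the endpoint attached to the
  cycle), and \<open>j\<close> is the junction.\<close>

definition tadpole :: "'v wgraph \<Rightarrow> bool" where
  "tadpole G \<longleftrightarrow> (\<exists>xs ys j.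
     distinct (xs @ ys) \<and> 3 \<le> length xs \<and> 1 \<le> length ys \<and> j \<in> set xs \<and>
     verts G = set xs \<union> set ys \<and>
     edges G = cycle_edges xs \<union> path_edges ys \<union> {{j, hd ys}})"

text \<open>A walk is represented by the nonempty list of its vertices.\<close>

definition walk_cost :: "'v wgraph \<Rightarrow> 'v list \<Rightarrow> real" where
  "walk_cost G w = (\<Sum>i < length w - 1. weight G {w ! i, w ! Suc i})"

definition exploration_tour :: "'v wgraph \<Rightarrow> 'v \<Rightarrow> 'v list \<Rightarrow> bool" where
  "exploration_tour G s w \<longleftrightarrow>
     w \<noteq> [] \<and> hd w = s \<and> last w = s \<and>
     successively (\<lambda>u v. {u, v} \<in> edges G) w \<and> set w = verts G"

text \<open>The infimum is attained for connected finite graphs with positive weights.\<close>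

definition cost_opt :: "'v wgraph \<Rightarrow> 'v \<Rightarrow> real" where
  "cost_opt G s = (INF w \<in> {w. exploration_tour G s w}. walk_cost G w)"

text \<open>What the searcher learns on arriving at a vertex: the identifier of that vertex, and, as a
  finite map, the identifiers of its neighbours together with the weights of the connecting edges.\<close>

type_synonym 'v view = "'v \<times> ('v \<Rightarrow> real option)"

definition local_view :: "'v wgraph \<Rightarrow> 'v \<Rightarrow> 'v view" where
  "local_view G v = (v, \<lambda>u. if {v, u} \<in> edges G then Some (weight G {v, u}) else None)"

text \<open>A deterministic online algorithm maps the advice and the sequence of views collected so far
  (oldest first) to its next action: \<open>Some v\<close> is a move along an edge to \<open>v\<close>, \<open>None\<close> ends the
  exploration. It has no other access to the graph; in particular, the number of vertices is not
  part of its input.\<close>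

type_synonym 'v online_alg = "bool list \<Rightarrow> 'v view list \<Rightarrow> 'v option"

inductive partial_run :: "'v online_alg \<Rightarrow> bool list \<Rightarrow> 'v wgraph \<Rightarrow> 'v \<Rightarrow> 'v list \<Rightarrow> bool"
  for A :: "'v online_alg" and adv :: "bool list" and G :: "'v wgraph" and s :: 'v
where
  start: "partial_run A adv G s [s]"
| move: "partial_run A adv G s w \<Longrightarrow> A adv (map (local_view G) w) = Some v \<Longrightarrow>
    {last w, v} \<in> edges G \<Longrightarrow> partial_run A adv G s (w @ [v])"

text \<open>For given arguments there is at most one completed run. There is none if the algorithm
  never stops or attempts to move to a vertex that is not a neighbour.\<close>

definition completed_run :: "'v online_alg \<Rightarrow> bool list \<Rightarrow> 'v wgraph \<Rightarrow> 'v \<Rightarrow> 'v list \<Rightarrow> bool" where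
  "completed_run A adv G s w \<longleftrightarrow>
     partial_run A adv G s w \<and> A adv (map (local_view G) w) = None"

end

theory Submission
  imports Defs
begin

text \<open>Let \<open>W\<close> be the total weight and \<open>C\<close> the weight of the cycle. A closed walk that visits every
  vertex crosses each bridge twice. So a tour using all cycle edges costs at least \<open>2 W - C\<close>, and a
  tour avoiding a cycle edge \<open>e\<close> costs at least \<open>2 (W - c e)\<close>. The first advice bit tells which of the
  two bounds, the latter for the heaviest cycle edge \<open>e\<close>, is smaller; the remaining bits
  encode a number below \<open>n\<close>.

  In the second case the searcher performs depth-first search in the tree obtained by deleting \<open>e\<close>,
  which crosses every tree edge twice. The number is how many vertices have been visited
  when the search is first about to cross \<open>e\<close>; that crossing is skipped.

  In the first case the searcher performs depth-first search but closes the cycle rather than retracing it.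
  This costs \<open>2 W - C\<close> provided that the stem has been explored before the cycle is closed.
  The number is the position of the stem among the neighbours of the junction, and the search always
  prefers the neighbour in that position.\<close>

section \<open>Edge sets of paths and cycles\<close>

lemma path_edges_simps [simp]:
  "path_edges [] = {}"
  "path_edges [x] = {}"
  "path_edges (x # y # zs) = insert {x, y} (path_edges (y # zs))"
proof -
  show "path_edges (x # y # zs) = insert {x, y} (path_edges (y # zs))"
  proof (intro equalityI subsetI)
    fix f assume "f \<in> path_edges (x # y # zs)"
    then obtain i where "f = {(x # y # zs) ! i, (x # y # zs) ! Suc i}" "Suc i < length (x # y # zs)"
      unfolding path_edges_def by blast
    then show "f \<in> insert {x, y} (path_edges (y # zs))"
      by (cases i) (auto simp: path_edges_def)
  next
    fix f assume "f \<in> insert {x, y} (path_edges (y # zs))"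
    then consider "f = {x, y}" | i where "f = {(y # zs) ! i, (y # zs) ! Suc i}" "Suc i < length (y # zs)"
      unfolding path_edges_def by blast
    then show "f \<in> path_edges (x # y # zs)"
    proof cases
      case 1
      then show ?thesis unfolding path_edges_def by (intro CollectI exI[of _ 0]) auto
    next
      case (2 i)
      then show ?thesis unfolding path_edges_def by (intro CollectI exI[of _ "Suc i"]) auto
    qed
  qed
qed (auto simp: path_edges_def)

lemma path_edges_append:
  "xs \<noteq> [] \<Longrightarrow> ys \<noteq> [] \<Longrightarrow>
   path_edges (xs @ ys) = insert {last xs, hd ys} (path_edges xs \<union> path_edges ys)"
proof (induction xs rule: induct_list012)
  case (2 x)
  then show ?case by (cases ys) auto
qed auto

lemma path_edges_Cons:
  "ys \<noteq> [] \<Longrightarrow> path_edges (x # ys) = insert {x, hd ys} (path_edges ys)"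
  by (cases ys) auto

lemma nth_path_edges: "Suc i < length xs \<Longrightarrow> {xs ! i, xs ! Suc i} \<in> path_edges xs"
  unfolding path_edges_def by blast

lemma path_edges_subset: "f \<in> path_edges xs \<Longrightarrow> f \<subseteq> set xs"
  by (induction xs rule: induct_list012) auto

lemma finite_path_edges [simp]: "finite (path_edges xs)"
  by (induction xs rule: induct_list012) auto

lemma cycle_edges_subset: "xs \<noteq> [] \<Longrightarrow> f \<in> cycle_edges xs \<Longrightarrow> f \<subseteq> set xs"
  by (auto simp: cycle_edges_def dest: path_edges_subset)

lemma finite_cycle_edges [simp]: "finite (cycle_edges xs)"
  by (simp add: cycle_edges_def)

lemma path_edges_split:
  assumes "f \<in> path_edges xs"
  obtains as bs where "xs = as @ bs" "as \<noteq> []" "bs \<noteq> []" "f = {last as, hd bs}"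
proof -
  obtain i where i: "f = {xs ! i, xs ! Suc i}" "Suc i < length xs"
    using assms unfolding path_edges_def by blast
  then have "last (take (Suc i) xs) = xs ! i" "hd (drop (Suc i) xs) = xs ! Suc i"
    by (simp_all add: take_Suc_conv_app_nth hd_drop_conv_nth)
  then show thesis
    using i by (intro that[of "take (Suc i) xs" "drop (Suc i) xs"]) auto
qed

lemma successively_iff_path_edges:
  "successively (\<lambda>u v. {u, v} \<in> E) xs \<longleftrightarrow> path_edges xs \<subseteq> E"
  by (induction xs rule: induct_list012) auto

lemma path_edges_closed:
  assumes "x \<in> set xs" "x \<in> S"
    and "\<And>a b. {a, b} \<in> path_edges xs \<Longrightarrow> a \<in> S \<Longrightarrow> b \<in> S"
  shows "set xs \<subseteq> S"
  using assms
proof (induction xs arbitrary: x rule: induct_list012)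
  case (3 y z zs)
  have "z \<in> S"
  proof (cases "x = y")
    case True
    then show ?thesis using "3.prems"(2) "3.prems"(3)[of y z] by simp
  next
    case False
    then show ?thesis using "3.IH"(2)[of x] "3.prems" by auto
  qed
  moreover have "y \<in> S"
    using \<open>z \<in> S\<close> "3.prems"(3)[of z y] by (simp add: insert_commute)
  ultimately show ?case using "3.IH"(2)[of z] "3.prems"(3) by auto
qed auto

lemma cycle_edges_append:
  assumes "xs \<noteq> []" "ys \<noteq> []"
  shows "cycle_edges (xs @ ys) = cycle_edges (ys @ xs)"
  using assms by (auto simp: cycle_edges_def path_edges_append)

text \<open>A cyclic list can be cut at any of its edges. Facts about deleting a cycle edge then
  need a proof for the closing edge only.\<close>

lemma cycle_edges_rotate:
  assumes "e \<in> cycle_edges xs" "xs \<noteq> []"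
  obtains xs' where "cycle_edges xs' = cycle_edges xs" "set xs' = set xs" "length xs' = length xs"
    "distinct xs' = distinct xs" "e = {last xs', hd xs'}"
proof (cases "e = {last xs, hd xs}")
  case False
  then have "e \<in> path_edges xs" using assms by (simp add: cycle_edges_def)
  then obtain as bs where "xs = as @ bs" "as \<noteq> []" "bs \<noteq> []" "e = {last as, hd bs}"
    by (rule path_edges_split)
  then show thesis
    using cycle_edges_append[of as bs] by (intro that[of "bs @ as"]) auto
qed (use that in blast)

text \<open>After rotating \<open>x\<close> to the front, its neighbours are the second and the last
  entry; three vertices suffice to keep these apart.\<close>

lemma cycle_edges_neighbours:
  assumes "distinct xs" "3 \<le> length xs" "x \<in> set xs"
  obtains a b where "a \<noteq> b" "a \<noteq> x" "b \<noteq> x" "\<And>u. {x, u} \<in> cycle_edges xs \<longleftrightarrow> u = a \<or> u = b"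
proof -
  obtain as bs where xs: "xs = as @ x # bs" using assms(3) by (meson split_list)
  have eq: "cycle_edges xs = cycle_edges (x # bs @ as)"
    using cycle_edges_append[of as "x # bs"] xs by (cases "as = []") auto
  obtain a zs where zs: "bs @ as = a # zs" "zs \<noteq> []"
  proof (cases "bs @ as")
    case (Cons a zs)
    moreover have "length (bs @ as) \<ge> 2" using assms(2) xs by simp
    ultimately show ?thesis using that by (cases zs) auto
  qed (use assms(2) xs in auto)
  have d: "distinct (x # a # zs)"
    using assms(1) unfolding xs zs(1)[symmetric] by auto
  have l: "last zs \<in> set zs" using zs by simp
  have "{x, u} \<in> cycle_edges xs \<longleftrightarrow> u = a \<or> u = last zs" for u
  proof -
    have "{x, u} \<notin> path_edges (a # zs)" using d path_edges_subset[of "{x, u}" "a # zs"] by auto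
    then have "{x, u} \<in> cycle_edges (x # a # zs) \<longleftrightarrow> u = a \<or> u = last zs"
      unfolding cycle_edges_def using d zs l by (auto simp: doubleton_eq_iff)
    then show ?thesis by (simp only: eq zs)
  qed
  then show thesis using d l by (intro that[of a "last zs"]) auto
qed

section \<open>Costs and crossings of walks\<close>

fun path_cost :: "('v set \<Rightarrow> real) \<Rightarrow> 'v list \<Rightarrow> real" where
  "path_cost c (x # y # zs) = c {x, y} + path_cost c (y # zs)"
| "path_cost c _ = 0"

lemma path_cost_Cons: "xs \<noteq> [] \<Longrightarrow> path_cost c (x # xs) = c {x, hd xs} + path_cost c xs"
  by (cases xs) auto

lemma path_cost_append:
  "path_cost c (xs @ y # ys) = path_cost c (xs @ [y]) + path_cost c (y # ys)"
  by (induction xs rule: induct_list012) auto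

lemma walk_cost_snoc:
  "w \<noteq> [] \<Longrightarrow> walk_cost G (w @ [v]) = walk_cost G w + weight G {last w, v}"
proof -
  assume "w \<noteq> []"
  then obtain n where n: "length w = Suc n" by (cases w) auto
  have "w ! n = last w" using n by (metis diff_Suc_1 last_conv_nth list.size(3) nat.distinct(1))
  moreover have "(\<Sum>i<n. weight G {(w @ [v]) ! i, (w @ [v]) ! Suc i}) = (\<Sum>i<n. weight G {w ! i, w ! Suc i})"
    using n by (intro sum.cong) (auto simp: nth_append)
  ultimately show ?thesis using n by (simp add: walk_cost_def nth_append)
qed

text \<open>Histories are kept newest vertex first, so costs are computed by recursion at the head.
  Edges are unordered, so reversal is harmless.\<close>

lemma walk_cost_rev: "walk_cost G (rev r) = path_cost (weight G) r"
proof (induction r)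
  case (Cons x r)
  show ?case
  proof (cases "r = []")
    case False
    then show ?thesis
      using Cons walk_cost_snoc[of "rev r" G x] by (simp add: path_cost_Cons last_rev insert_commute)
  qed (simp add: walk_cost_def)
qed (simp add: walk_cost_def)

lemma path_cost_ge_sum:
  assumes "\<And>f. f \<in> path_edges xs \<Longrightarrow> 0 \<le> c f"
  shows "sum c (path_edges xs) \<le> path_cost c xs"
  using assms
proof (induction xs rule: induct_list012)
  case (3 x y zs)
  then have "sum c (path_edges (y # zs)) \<le> path_cost c (y # zs)" "0 \<le> c {x, y}" by auto
  then show ?case by (simp add: sum.insert_if)
qed auto

lemma walk_leaves_set:
  assumes "p \<le> q" "w ! p \<in> S" "w ! q \<notin> S"
  obtains i where "p \<le> i" "i < q" "w ! i \<in> S" "w ! Suc i \<notin> S"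
  using assms
proof (induction q arbitrary: thesis)
  case (Suc q)
  have "p \<noteq> Suc q" using Suc.prems by auto
  then have "p \<le> q" using Suc.prems by simp
  show ?case
  proof (cases "w ! q \<in> S")
    case True
    then show ?thesis using Suc.prems \<open>p \<le> q\<close> by auto
  next
    case False
    then show ?thesis
      using Suc.IH[OF _ \<open>p \<le> q\<close>] Suc.prems by (metis less_SucI)
  qed
qed simp

text \<open>A walk starting inside \<open>S\<close> must leave \<open>S\<close> before reaching
  \<open>y\<close> and re-enter it to get back to its start. If it starts outside, the complement
  and \<open>x\<close> take these roles.\<close>

lemma closed_walk_crosses_twice:
  assumes w: "hd w = last w" and x: "x \<in> set w" "x \<in> S" and y: "y \<in> set w" "y \<notin> S"
  obtains i k where "Suc i < length w" "w ! i \<in> S" "w ! Suc i \<notin> S"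
    "Suc k < length w" "w ! k \<notin> S" "w ! Suc k \<in> S"
proof -
  have *: "\<exists>i k. Suc i < length w \<and> w ! i \<in> T \<and> w ! Suc i \<notin> T \<and>
      Suc k < length w \<and> w ! k \<notin> T \<and> w ! Suc k \<in> T"
    if T: "hd w \<in> T" "z \<in> set w" "z \<notin> T" for z T
  proof -
    obtain q where q: "q < length w" "w ! q = z" using T by (meson in_set_conv_nth)
    have ne: "w \<noteq> []" using T by auto
    obtain i where i: "i < q" "w ! i \<in> T" "w ! Suc i \<notin> T"
      using walk_leaves_set[of 0 q w T] q T ne by (auto simp: hd_conv_nth)
    obtain k where k: "k < length w - 1" "w ! k \<in> - T" "w ! Suc k \<notin> - T"
    proof (rule walk_leaves_set[of q "length w - 1" w "- T"])
      show "w ! (length w - 1) \<notin> - T" using T w ne by (simp add: last_conv_nth)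
    qed (use q T in auto)
    show ?thesis using i k q by (intro exI[of _ i] exI[of _ k]) auto
  qed
  show thesis
  proof (cases "hd w \<in> S")
    case True
    then show ?thesis using *[of S y] y that by blast
  next
    case False
    then show ?thesis using *[of "- S" x] x that by auto
  qed
qed

section \<open>Depth-first search and its stack\<close>

text \<open>The depth-first search stack is a function of the walk alone: entering a new vertex pushes
  it, entering a visited vertex cuts the stack back to it. From here on walks are reversed, so that
  the current vertex comes first.\<close>

primrec dfs_stack :: "'v list \<Rightarrow> 'v list" where
  "dfs_stack [] = []"
| "dfs_stack (v # r) = (if v \<in> set r then dropWhile (\<lambda>x. x \<noteq> v) (dfs_stack r) else v # dfs_stack r)"

text \<open>\<open>E\<close> is the graph that the search effectively sees: all edges, or all but
  the skipped one. The last conjunct is the finishing property of depth-first search, from which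
  completeness follows at the end.\<close>

definition dfs_inv :: "'v set set \<Rightarrow> 'v \<Rightarrow> 'v list \<Rightarrow> bool" where
  "dfs_inv E s r \<longleftrightarrow> r \<noteq> [] \<and> last r = s \<and> path_edges r \<subseteq> E \<and>
     dfs_stack r \<noteq> [] \<and> hd (dfs_stack r) = hd r \<and> last (dfs_stack r) = s \<and> distinct (dfs_stack r) \<and>
     set (dfs_stack r) \<subseteq> set r \<and> path_edges (dfs_stack r) \<subseteq> E \<and>
     (\<forall>x \<in> set r - set (dfs_stack r). \<forall>u. {x, u} \<in> E \<longrightarrow> u \<in> set r)"

lemma dfs_inv_start: "dfs_inv E s [s]"
  by (simp add: dfs_inv_def)

lemma dfs_inv_push:
  assumes "dfs_inv E s r" "{hd r, u} \<in> E" "u \<notin> set r"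
  shows "dfs_inv E s (u # r)" "dfs_stack (u # r) = u # dfs_stack r"
  using assms by (auto simp: dfs_inv_def path_edges_Cons insert_commute)

text \<open>Covers both ways of moving to a visited vertex: backtracking, where \<open>as\<close>
  holds just the current vertex, and closing a cycle, where a longer segment of the stack is cut
  off.\<close>

lemma dfs_inv_back:
  assumes "dfs_inv E s r" and st: "dfs_stack r = as @ u # bs" and "{hd r, u} \<in> E"
    and "\<And>x z. x \<in> set as \<Longrightarrow> {x, z} \<in> E \<Longrightarrow> z \<in> set r"
  shows "dfs_inv E s (u # r)" "dfs_stack (u # r) = u # bs"
proof -
  have u: "u \<in> set r" "u \<notin> set as" using assms(1) st by (auto simp: dfs_inv_def)
  then have "dropWhile (\<lambda>x. x \<noteq> u) (as @ u # bs) = u # bs"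
    by (subst dropWhile_append2) auto
  then show st': "dfs_stack (u # r) = u # bs" using u st by simp
  have "path_edges (u # bs) \<subseteq> path_edges (as @ u # bs)"
    by (cases "as = []") (auto simp: path_edges_append)
  moreover have "path_edges (as @ u # bs) \<subseteq> E" using assms(1) st by (simp add: dfs_inv_def)
  ultimately have "path_edges (u # bs) \<subseteq> E" by (rule order_trans)
  moreover have "path_edges (u # r) \<subseteq> E"
    using assms(1,3) by (simp add: dfs_inv_def path_edges_Cons insert_commute)
  moreover have "z \<in> set (u # r)" if "x \<in> set (u # r) - set (u # bs)" "{x, z} \<in> E" for x z
  proof (cases "x \<in> set as")
    case False
    then have "x \<in> set r - set (dfs_stack r)" using that st by auto
    then show ?thesis using assms(1) that(2) by (auto simp: dfs_inv_def)
  qed (use assms(4) that in auto)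
  moreover have "set (u # bs) \<subseteq> set (u # r)" "distinct (u # bs)" "last (u # bs) = s" "last (u # r) = s"
    using assms(1) st by (auto simp: dfs_inv_def)
  ultimately show "dfs_inv E s (u # r)" unfolding dfs_inv_def st' by simp
qed

text \<open>The single stack entry is both the current vertex and the start, and every other visited
  vertex is finished. So the visited set is closed under adjacency, as the connectedness lemmas
  require.\<close>

lemma dfs_inv_final:
  assumes "dfs_inv E s r" "tl (dfs_stack r) = []" "\<And>u. {hd r, u} \<in> E \<Longrightarrow> u \<in> set r"
  shows "dfs_stack r = [s]" "hd r = s" "s \<in> set r" "\<And>x u. {x, u} \<in> E \<Longrightarrow> x \<in> set r \<Longrightarrow> u \<in> set r"
proof -
  have stack: "dfs_stack r \<noteq> []" "hd (dfs_stack r) = hd r" "last (dfs_stack r) = s" "set (dfs_stack r) \<subseteq> set r"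
    using assms(1) unfolding dfs_inv_def by blast+
  then show st: "dfs_stack r = [s]"
    using assms(2) by (metis last_ConsL list.collapse)
  show hd: "hd r = s" "s \<in> set r" using stack(2,4) unfolding st by auto
  have fin: "\<forall>x \<in> set r - set (dfs_stack r). \<forall>u. {x, u} \<in> E \<longrightarrow> u \<in> set r"
    using assms(1) unfolding dfs_inv_def by blast
  show "u \<in> set r" if "{x, u} \<in> E" "x \<in> set r" for x u
  proof (cases "x = s")
    case True
    then show ?thesis using that(1) hd assms(3)[of u] by simp
  next
    case False
    then have "x \<in> set r - set (dfs_stack r)" using that(2) st by simp
    then show ?thesis using fin that(1) by blast
  qed
qed

section \<open>Runs of strategies on histories\<close>

text \<open>Runs stripped of views, advice and adjacency checks;
  \<open>partial_run_of_follows\<close> translates them back.\<close>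

fun follows :: "('v list \<Rightarrow> 'v option) \<Rightarrow> 'v \<Rightarrow> 'v list \<Rightarrow> bool" where
  "follows act s [] = False"
| "follows act s [x] = (x = s)"
| "follows act s (u # v # r) = (act (v # r) = Some u \<and> follows act s (v # r))"

lemma follows_Cons: "r \<noteq> [] \<Longrightarrow> follows act s (u # r) \<longleftrightarrow> act r = Some u \<and> follows act s r"
  by (cases r) auto

lemma run_terminates:
  assumes "I [s]"
    and step: "\<And>r u. I r \<Longrightarrow> act r = Some u \<Longrightarrow> r \<noteq> [] \<Longrightarrow> I (u # r) \<and> \<mu> (u # r) < (\<mu> r :: nat)"
  obtains r where "follows act s r" "act r = None" "I r"
proof -
  have "\<exists>r. follows act s r \<and> act r = None \<and> I r" if "follows act s r" "I r" for r
    using that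
  proof (induction "\<mu> r" arbitrary: r rule: less_induct)
    case less
    have ne: "r \<noteq> []" using less.prems by auto
    show ?case
    proof (cases "act r")
      case (Some u)
      then show ?thesis
        using less.hyps[of "u # r"] less.prems step[of r u] ne by (simp add: follows_Cons)
    qed (use less in blast)
  qed
  from this[of "[s]"] show thesis using assms(1) that by auto
qed

lemma partial_run_of_follows:
  assumes "follows act s r" "path_edges r \<subseteq> edges G"
    and "\<And>q. q \<noteq> [] \<Longrightarrow> A adv (map (local_view G) (rev q)) = act q"
  shows "partial_run A adv G s (rev r)"
  using assms(1,2)
proof (induction r)
  case (Cons u r)
  show ?case
  proof (cases "r = []")
    case False
    then have "{last (rev r), u} \<in> edges G"
      using Cons.prems by (simp add: path_edges_Cons last_rev insert_commute)
    then show ?thesis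
      using Cons False assms(3)[of r]
      by (auto simp: follows_Cons path_edges_Cons intro: partial_run.move)
  qed (use Cons.prems in \<open>auto intro: partial_run.start\<close>)
qed simp

section \<open>The two search strategies and the explorer\<close>

text \<open>The order is arbitrary but determined by the set alone, so oracle and searcher agree on
  what a position means.\<close>

definition enumeration :: "'v set \<Rightarrow> 'v list" where
  "enumeration N = (SOME xs. set xs = N \<and> distinct xs)"

text \<open>The position is meant for the junction but applied at every vertex. Where it is out of
  range, the list access is unspecified; the membership test keeps the choice inside a nonempty
  \<open>C\<close> regardless.\<close>

definition pick :: "nat \<Rightarrow> 'v set \<Rightarrow> 'v set \<Rightarrow> 'v" where
  "pick k N C = (if enumeration N ! k \<in> C then enumeration N ! k else SOME u. u \<in> C)"

lemma pick_in: "C \<noteq> {} \<Longrightarrow> pick k N C \<in> C"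
  by (simp add: pick_def some_in_eq)

lemma ex_enumeration_index:
  assumes "finite N" "x \<in> N"
  obtains k where "k < card N" "enumeration N ! k = x"
proof -
  have "set (enumeration N) = N \<and> distinct (enumeration N)"
    unfolding enumeration_def using finite_distinct_list[OF assms(1)] by (rule someI_ex)
  then show thesis using assms(2) that by (metis distinct_card in_set_conv_nth)
qed

definition fresh :: "('v \<Rightarrow> 'v set) \<Rightarrow> 'v list \<Rightarrow> 'v set" where
  "fresh N r = N (hd r) - set r"

definition backtrack :: "'v list \<Rightarrow> 'v option" where
  "backtrack r = (if tl (dfs_stack r) = [] then None else Some (hd (tl (dfs_stack r))))"

text \<open>Depth-first search that, instead of retracing a cycle it has just gone round, takes the
  edge closing that cycle. The \<open>k\<close>-th neighbour of each vertex is preferred.\<close>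

definition cycle_act :: "nat \<Rightarrow> ('v \<Rightarrow> 'v set) \<Rightarrow> 'v list \<Rightarrow> 'v option" where
  "cycle_act k N r =
     (if fresh N r \<noteq> {} then Some (pick k (N (hd r)) (fresh N r))
      else if set (drop 2 (dfs_stack r)) \<inter> N (hd r) \<noteq> {}
        then Some (SOME u. u \<in> set (drop 2 (dfs_stack r)) \<inter> N (hd r))
      else backtrack r)"

text \<open>The first edge to an unvisited vertex that is about to be taken while the set of visited
  vertices and that edge satisfy \<open>P\<close>, as a set of at most one edge.\<close>

primrec skipped :: "('v set \<Rightarrow> 'v set \<Rightarrow> bool) \<Rightarrow> ('v \<Rightarrow> 'v set) \<Rightarrow> 'v list \<Rightarrow> 'v set set" where
  "skipped P N [] = {}"
| "skipped P N (v # r) =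
     (if skipped P N r \<noteq> {} then skipped P N r
      else if fresh N (v # r) \<noteq> {} \<and> P (set (v # r)) {v, SOME u. u \<in> fresh N (v # r)}
        then {{v, SOME u. u \<in> fresh N (v # r)}}
      else {})"

text \<open>\<open>P\<close> is the trigger for skipping. The analysis tests for the edge
  \<open>e\<close> itself, which the searcher does not know; the algorithm tests the number of
  visited vertices.\<close>

definition tree_act :: "('v set \<Rightarrow> 'v set \<Rightarrow> bool) \<Rightarrow> ('v \<Rightarrow> 'v set) \<Rightarrow> 'v list \<Rightarrow> 'v option" where
  "tree_act P N r =
     (let C = {u \<in> fresh N r. {hd r, u} \<notin> skipped P N r}
      in if C \<noteq> {} then Some (SOME u. u \<in> C) else backtrack r)"

definition view_nbrs :: "'v view list \<Rightarrow> 'v \<Rightarrow> 'v set" where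
  "view_nbrs vs v = {u. \<exists>m. (v, m) \<in> set vs \<and> m u \<noteq> None}"

text \<open>\<open>k\<close> is read in binary, lowest bit first. It is a neighbour position in one
  branch and a number of visited vertices in the other.\<close>

definition explorer :: "'v online_alg" where
  "explorer adv vs =
     (let k = horner_sum of_bool 2 (tl adv); N = view_nbrs vs; r = rev (map fst vs)
      in if hd adv then cycle_act k N r else tree_act (\<lambda>S _. card S = k) N r)"

lemma skipped_cong:
  "(\<And>v. v \<in> set r \<Longrightarrow> N v = N' v) \<Longrightarrow> skipped P N r = skipped P N' r"
  by (induction r) (simp_all add: fresh_def)

definition nbrs :: "'v set set \<Rightarrow> 'v \<Rightarrow> 'v set" where
  "nbrs E v = {u. {v, u} \<in> E}"

text \<open>Both strategies consult neighbour sets of visited vertices only, and for these the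
  collected views are complete. So the analysis may use the true neighbour function.\<close>

lemma explorer_eq:
  assumes "q \<noteq> []"
  shows "explorer (b # bs) (map (local_view G) (rev q)) =
    (if b then cycle_act (horner_sum of_bool 2 bs) (nbrs (edges G)) q
     else tree_act (\<lambda>S _. card S = horner_sum of_bool 2 bs) (nbrs (edges G)) q)"
proof -
  define N where "N = view_nbrs (map (local_view G) (rev q))"
  have r: "rev (map fst (map (local_view G) (rev q))) = q"
    by (simp add: rev_map o_def local_view_def)
  have N: "N v = nbrs (edges G) v" if "v \<in> set q" for v
    using that by (auto simp: N_def view_nbrs_def nbrs_def local_view_def split: if_splits)
  then have "N (hd q) = nbrs (edges G) (hd q)" using assms by simp
  moreover from this have "fresh N q = fresh (nbrs (edges G)) q" by (simp add: fresh_def)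
  moreover have "skipped P N q = skipped P (nbrs (edges G)) q" for P
    using N by (rule skipped_cong)
  ultimately show ?thesis
    unfolding explorer_def r Let_def N_def[symmetric] by (simp add: cycle_act_def tree_act_def)
qed

section \<open>Finding the skipped edge by counting\<close>

lemma skipped_edge_subset: "skipped (\<lambda>_ f. f = e) N r \<subseteq> {e}"
  by (induction r) auto

lemma skipped_suffix: "skipped P N r \<noteq> {} \<Longrightarrow> skipped P N (q @ r) = skipped P N r"
  by (induction q) auto

text \<open>Between the moments at which an edge to an unvisited vertex is about to be taken, the number
  of visited vertices grows. So counting them identifies the moment at which \<open>e\<close> has to be skipped.\<close>

lemma skip_by_counting:
  assumes run: "follows (tree_act (\<lambda>_ f. f = e) N) s r"
    and V: "finite V" "set r \<subseteq> V" "\<And>v. v \<in> V \<Longrightarrow> N v \<subseteq> V"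
  obtains k where "k < card V"
    "\<And>q p. r = p @ q \<Longrightarrow> skipped (\<lambda>S _. card S = k) N q = skipped (\<lambda>_ f. f = e) N q"
proof (cases "skipped (\<lambda>_ f. f = e) N r = {}")
  case True
  \<comment> \<open>If \<open>e\<close> is never about to be crossed, the count \<open>0\<close>
    serves: a nonempty history has visited some vertex, so it never triggers.\<close>
  have "skipped (\<lambda>S _. card S = 0) N q = {}" for q by (induction q) auto
  moreover have "skipped (\<lambda>_ f. f = e) N q = {}" if "r = p @ q" for p q
    using True skipped_suffix that by metis
  moreover have "r \<noteq> []" using run by auto
  then have "0 < card V" using V by (auto simp: card_gt_0_iff)
  ultimately show thesis using that by auto
next
  case False
  have "\<exists>p v q. t = p @ v # q \<and> skipped P N q = {} \<and> skipped P N (v # q) \<noteq> {}"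
    if "skipped P N t \<noteq> {}" for P t
    using that
  proof (induction t)
    case (Cons v t)
    then show ?case by (metis append_Cons append_Nil)
  qed simp
  \<comment> \<open>\<open>v # q0\<close> is the history at which \<open>e\<close> is first about to
    be taken.\<close>
  then obtain p0 v q0 where r: "r = p0 @ v # q0"
    and before: "skipped (\<lambda>_ f. f = e) N q0 = {}" and skip: "skipped (\<lambda>_ f. f = e) N (v # q0) \<noteq> {}"
    using False by blast
  define k where "k = card (set (v # q0))"
  have fr: "fresh N (v # q0) \<noteq> {}"
    and e: "{v, SOME u. u \<in> fresh N (v # q0)} = e"
    using before skip by (auto split: if_splits)
  have fol: "follows (tree_act (\<lambda>_ f. f = e) N) s (t @ q)
      \<Longrightarrow> q \<noteq> [] \<Longrightarrow> follows (tree_act (\<lambda>_ f. f = e) N) s q" for t q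
    by (induction t) (auto simp: follows_Cons)
  have early: "skipped (\<lambda>S _. card S = k) N q = {}" if "q0 = t @ q" for t q
    using that
  proof (induction q arbitrary: t)
    case (Cons x q)
    have none: "skipped (\<lambda>_ f. f = e) N (x # q) = {}"
      using before Cons.prems skipped_suffix by metis
    obtain y t' where y: "v # t = t' @ [y]" by (metis append_butlast_last_id list.distinct(1))
    then have split: "v # q0 = t' @ y # x # q"
      using Cons.prems by (metis append_Cons append.assoc append_Nil)
    have "follows (tree_act (\<lambda>_ f. f = e) N) s (y # x # q)"
      using fol[of "p0 @ t'" "y # x # q"] run r split by simp
    then have act: "tree_act (\<lambda>_ f. f = e) N (x # q) = Some y" by simp
    \<comment> \<open>An earlier history with a fresh neighbour went on to a new vertex
      \<open>y\<close>, which is counted in \<open>k\<close> but not yet here. One without a fresh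
      neighbour cannot trigger at all.\<close>
    have "card (set (x # q)) < k" if "fresh N (x # q) \<noteq> {}"
    proof -
      have "y = (SOME u. u \<in> fresh N (x # q))"
        using act none that unfolding tree_act_def by (simp del: skipped.simps)
      then have "y \<notin> set (x # q)"
        using that some_in_eq[of "fresh N (x # q)"] by (auto simp: fresh_def)
      moreover have "set (y # x # q) \<subseteq> set (v # q0)" unfolding split by auto
      ultimately show ?thesis
        unfolding k_def by (intro psubset_card_mono) auto
    qed
    moreover have "skipped (\<lambda>S _. card S = k) N q = {}"
      using Cons.IH[of "t @ [x]"] Cons.prems by simp
    ultimately show ?case by auto
  qed simp
  have now: "skipped (\<lambda>S _. card S = k) N (v # q0) = {e}"
    using early[of "[]" q0] fr e by (simp add: k_def)
  have "skipped (\<lambda>_ f. f = e) N (v # q0) = {e}"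
    using skip skipped_edge_subset[of e N "v # q0"] by blast
  then have "skipped (\<lambda>S _. card S = k) N q = skipped (\<lambda>_ f. f = e) N q" if "r = p @ q" for p q
  proof -
    \<comment> \<open>Either \<open>q\<close> is older than the trigger, where both tests have
      skipped nothing, or it extends the trigger, where both have skipped \<open>e\<close>.\<close>
    from that r consider t where "q0 = t @ q" | t where "q = t @ v # q0"
      by (auto simp: append_eq_append_conv2 append_eq_Cons_conv Cons_eq_append_conv)
    then show ?thesis
    proof cases
      case 1
      then show ?thesis using early before skipped_suffix by metis
    next
      case 2
      then show ?thesis
        using now \<open>skipped (\<lambda>_ f. f = e) N (v # q0) = {e}\<close> skipped_suffix by (metis insert_not_empty)
    qed
  qed
  moreover have "k < card V"
  proof -
    \<comment> \<open>A fresh neighbour is unvisited at the trigger, which makes the bound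
      strict.\<close>
    obtain u where "u \<in> fresh N (v # q0)" using fr by blast
    then have "u \<in> V - set (v # q0)" "set (v # q0) \<subseteq> V" using V r by (auto simp: fresh_def)
    then show ?thesis unfolding k_def using V(1) by (intro psubset_card_mono) auto
  qed
  ultimately show thesis using that by blast
qed

lemma follows_cong:
  assumes "follows act s r" "\<And>p q. r = p @ q \<Longrightarrow> q \<noteq> [] \<Longrightarrow> act q = act' q"
  shows "follows act' s r"
  using assms
proof (induction r)
  case (Cons u r)
  show ?case
  proof (cases "r = []")
    case False
    have "follows act' s r" using Cons False by (auto simp: follows_Cons)
    then show ?thesis using Cons.prems(1) Cons.prems(2)[of "[u]" r] False by (simp add: follows_Cons)
  qed (use Cons.prems in auto)
qed simp

section \<open>Structure of tadpoles\<close>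

locale tadpole_rep =
  fixes xs ys :: "'v list" and j :: 'v and E :: "'v set set"
  assumes dist: "distinct (xs @ ys)" and xs_len: "3 \<le> length xs" and ys_ne: "ys \<noteq> []"
    and j: "j \<in> set xs"
    and E: "E = cycle_edges xs \<union> path_edges ys \<union> {{j, hd ys}}"
begin

abbreviation (input) "V \<equiv> set xs \<union> set ys"

lemma xs_ne: "xs \<noteq> []" using xs_len by auto

lemma finite_E: "finite E" by (simp add: E)

lemma edge_subset: "f \<in> E \<Longrightarrow> f \<subseteq> V"
  using j ys_ne xs_ne by (auto simp: E dest: cycle_edges_subset path_edges_subset)

text \<open>The cycle has no chords: stem edges lie inside \<open>set ys\<close> and the joining
  edge contains \<open>hd ys\<close>.\<close>

lemma edge_in_cycle: "f \<in> E \<Longrightarrow> f \<subseteq> set xs \<Longrightarrow> f \<in> cycle_edges xs"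
proof -
  assume f: "f \<in> E" "f \<subseteq> set xs"
  have "f \<notin> path_edges ys"
  proof
    assume "f \<in> path_edges ys"
    then have "f \<subseteq> set ys" "f \<noteq> {}" by (auto dest: path_edges_subset simp: path_edges_def)
    then show False using f(2) dist by auto
  qed
  moreover have "f \<noteq> {j, hd ys}" using f(2) dist ys_ne by auto
  ultimately show ?thesis using f(1) by (simp add: E)
qed

lemma cycle_edge_iff: "f \<in> cycle_edges xs \<longleftrightarrow> f \<in> E \<and> f \<subseteq> set xs"
  using edge_in_cycle cycle_edges_subset[OF xs_ne] by (auto simp: E)

lemma no_loop: "{v, v} \<notin> E"
proof
  assume "{v, v} \<in> E"
  moreover have "{v, v} \<notin> cycle_edges xs"
  proof
    assume *: "{v, v} \<in> cycle_edges xs"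
    then have "v \<in> set xs" using cycle_edges_subset[OF xs_ne] by blast
    then obtain a b where "a \<noteq> v" "b \<noteq> v" "\<And>u. {v, u} \<in> cycle_edges xs \<longleftrightarrow> u = a \<or> u = b"
      using cycle_edges_neighbours[of xs v] dist xs_len by (metis distinct_append)
    then show False using * by metis
  qed
  moreover have "{v, v} \<notin> path_edges ys"
  proof
    assume "{v, v} \<in> path_edges ys"
    then obtain as bs where s: "ys = as @ bs" "as \<noteq> []" "bs \<noteq> []" "{v, v} = {last as, hd bs}"
      by (rule path_edges_split)
    then have "v = last as" "v = hd bs" by (auto simp: doubleton_eq_iff)
    then have "v \<in> set as" "v \<in> set bs" using s last_in_set hd_in_set by metis+
    then show False using dist s(1) by auto
  qed
  moreover have "{v, v} \<noteq> {j, hd ys}" using dist j ys_ne by (auto simp: doubleton_eq_iff)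
  ultimately show False by (simp add: E)
qed

lemma rotated:
  assumes "e \<in> cycle_edges xs"
  obtains xs' where "tadpole_rep xs' ys j E" "cycle_edges xs' = cycle_edges xs" "set xs' = set xs"
    "e = {last xs', hd xs'}"
proof -
  obtain xs' where "cycle_edges xs' = cycle_edges xs" "set xs' = set xs" "length xs' = length xs"
    "distinct xs' = distinct xs" "e = {last xs', hd xs'}"
    using cycle_edges_rotate[OF assms xs_ne] by blast
  moreover from this have "tadpole_rep xs' ys j E"
    using dist xs_len ys_ne j E by (simp add: tadpole_rep_def)
  ultimately show thesis using that by blast
qed

text \<open>If the closing edge also occurred between \<open>as\<close> and \<open>bs\<close>, both
  pieces would be single vertices, against length at least three.\<close>

lemma closing_edge_not_path: "{last xs, hd xs} \<notin> path_edges xs"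
proof
  assume "{last xs, hd xs} \<in> path_edges xs"
  then obtain as bs where s: "xs = as @ bs" "as \<noteq> []" "bs \<noteq> []" "{last xs, hd xs} = {last as, hd bs}"
    by (rule path_edges_split)
  have d: "distinct (as @ bs)" "3 \<le> length (as @ bs)" using dist xs_len s by auto
  have "last as \<in> set as" "last bs \<in> set bs" "hd as \<in> set as" "hd bs \<in> set bs" using s by auto
  then have "last as \<noteq> last bs" "hd as \<noteq> hd bs" using d(1) by auto
  then have "last bs = hd bs" "hd as = last as" using s by (auto simp: doubleton_eq_iff)
  then have "length as = 1" "length bs = 1" using d s
    by (metis distinct_append distinct.simps(2) hd_Cons_tl last_ConsR last_in_set length_0_conv length_Cons One_nat_def)+
  then show False using d by simp
qed

lemma E_minus_closing_edge:
  "E - {{last xs, hd xs}} = path_edges xs \<union> path_edges ys \<union> {{j, hd ys}}"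
proof -
  have "{last xs, hd xs} \<subseteq> set xs" using xs_ne by simp
  moreover have "\<not> {j, hd ys} \<subseteq> set xs" using ys_ne dist by auto
  ultimately have "{last xs, hd xs} \<noteq> {j, hd ys}" by metis
  moreover have "{last xs, hd xs} \<notin> path_edges ys"
    using path_edges_subset[of "{last xs, hd xs}" ys] dist xs_ne by (auto dest: hd_in_set)
  ultimately show ?thesis
    using closing_edge_not_path by (auto simp: E cycle_edges_def)
qed

text \<open>Without the closing edge, two paths joined at the junction remain; membership in
  \<open>S\<close> spreads along each and across.\<close>

lemma connected_path:
  assumes s: "s \<in> V" "s \<in> S"
    and closed: "\<And>a b. {a, b} \<in> E - {{last xs, hd xs}} \<Longrightarrow> a \<in> S \<Longrightarrow> b \<in> S"
  shows "V \<subseteq> S"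
proof -
  have cl: "\<And>a b. {a, b} \<in> path_edges xs \<union> path_edges ys \<union> {{j, hd ys}} \<Longrightarrow> a \<in> S \<Longrightarrow> b \<in> S"
    using closed unfolding E_minus_closing_edge .
  have hy: "hd ys \<in> set ys" using ys_ne by simp
  have X: "set xs \<subseteq> S" if "x \<in> set xs" "x \<in> S" for x
    using path_edges_closed[OF that] cl by blast
  have Y: "set ys \<subseteq> S" if "y \<in> set ys" "y \<in> S" for y
    using path_edges_closed[OF that] cl by blast
  have j1: "j \<in> S \<Longrightarrow> hd ys \<in> S" using cl[of j "hd ys"] by simp
  have j2: "hd ys \<in> S \<Longrightarrow> j \<in> S" using cl[of "hd ys" j] by (simp add: insert_commute)
  show ?thesis using s X Y j1 j2 j hy by blast
qed

lemma connected_minus: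
  assumes e: "e \<in> cycle_edges xs" and s: "s \<in> V" "s \<in> S"
    and closed: "\<And>a b. {a, b} \<in> E - {e} \<Longrightarrow> a \<in> S \<Longrightarrow> b \<in> S"
  shows "V \<subseteq> S"
proof -
  obtain xs' where "tadpole_rep xs' ys j E" "set xs' = set xs" "e = {last xs', hd xs'}"
    using rotated[OF e] by blast
  then show ?thesis using tadpole_rep.connected_path[of xs' ys j E s S] s closed by simp
qed

lemma connected:
  assumes "s \<in> V" "s \<in> S" "\<And>a b. {a, b} \<in> E \<Longrightarrow> a \<in> S \<Longrightarrow> b \<in> S"
  shows "V \<subseteq> S"
  using connected_path[of s S] assms by blast

text \<open>Going inwards from the leaf, no stem vertex can have two neighbours on a simple cycle.\<close>

lemma simple_cycle_covers:
  assumes q: "distinct q" "3 \<le> length q" "cycle_edges q \<subseteq> E"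
  shows "set q \<subseteq> set xs" "cycle_edges xs \<subseteq> cycle_edges q" "set xs \<subseteq> set q"
proof -
  have q_ne: "q \<noteq> []" using q by auto
  have "set q \<inter> set ys = {}"
  proof (rule ccontr)
    assume "set q \<inter> set ys \<noteq> {}"
    then have "\<exists>y \<in> set ys. y \<in> set q" by blast
    \<comment> \<open>\<open>y\<close> is the vertex of \<open>q\<close> on the stem nearest to the
      leaf.\<close>
    then obtain as y bs where ys: "ys = as @ y # bs" "y \<in> set q" "\<forall>z \<in> set bs. z \<notin> set q"
      using split_list_last_prop[of ys "\<lambda>y. y \<in> set q"] by auto
    obtain a b where ab: "a \<noteq> b" "\<And>u. {y, u} \<in> cycle_edges q \<longleftrightarrow> u = a \<or> u = b"
      using cycle_edges_neighbours[OF q(1,2) ys(2)] by metis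
    \<comment> \<open>No vertex further towards the leaf is on \<open>q\<close>, so a neighbour of
      \<open>y\<close> on \<open>q\<close> can only be the one on the side of the junction.\<close>
    have "u = (if as = [] then j else last as)" if u: "{y, u} \<in> E" "u \<in> set q" for u
    proof -
      have y: "y \<notin> set xs" "y \<notin> set as" "y \<notin> set bs" using dist ys by auto
      have "{y, u} \<notin> cycle_edges xs" using cycle_edges_subset[OF xs_ne] y by blast
      then consider "{y, u} \<in> path_edges ys" | "{y, u} = {j, hd ys}" using u by (auto simp: E)
      then show ?thesis
      proof cases
        case 1
        have no: "{y, u} \<notin> path_edges bs" "{y, u} \<notin> path_edges as"
          using y path_edges_subset[of "{y, u}"] by auto
        have "{y, u} \<notin> path_edges (y # bs)"
        proof
          assume *: "{y, u} \<in> path_edges (y # bs)"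
          then have "bs \<noteq> []" by auto
          then have "{y, u} = {y, hd bs}" "hd bs \<in> set bs" using * no(1) by (auto simp: path_edges_Cons)
          then show False using ys(3) u(2) by (metis doubleton_eq_iff)
        qed
        then have "as \<noteq> []" "{y, u} = {last as, y}"
          using 1 no(2) unfolding ys(1) by (cases "as = []"; simp add: path_edges_append)+
        then show ?thesis by (auto simp: doubleton_eq_iff)
      next
        case 2
        then have "u = j" "y = hd ys" using y j by (auto simp: doubleton_eq_iff)
        moreover from this have "as = []" using y ys by (cases as) auto
        ultimately show ?thesis by simp
      qed
    qed
    moreover have "{y, a} \<in> cycle_edges q" "{y, b} \<in> cycle_edges q" using ab(2) by simp_all
    then have "a \<in> set q" "b \<in> set q" "{y, a} \<in> E" "{y, b} \<in> E"
      using q(3) cycle_edges_subset[OF q_ne, of "{y, a}"] cycle_edges_subset[OF q_ne, of "{y, b}"] by auto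
    ultimately show False using ab(1) by metis
  qed
  moreover have "set q \<subseteq> V"
  proof
    fix x assume "x \<in> set q"
    then obtain a where "{x, a} \<in> cycle_edges q" using cycle_edges_neighbours[OF q(1,2)] by metis
    then show "x \<in> V" using q(3) edge_subset by blast
  qed
  ultimately show qx: "set q \<subseteq> set xs" by blast
  have sub: "cycle_edges q \<subseteq> cycle_edges xs"
    using q(3) qx cycle_edges_subset[OF q_ne] edge_in_cycle by blast
  \<comment> \<open>At a vertex of \<open>q\<close>, the two neighbours along \<open>q\<close>
    already exhaust its two neighbours on the cycle.\<close>
  have nb: "{x, u} \<in> cycle_edges q" if x: "x \<in> set q" and u: "{x, u} \<in> cycle_edges xs" for x u
  proof -
    obtain a b where ab: "a \<noteq> b" "\<And>u. {x, u} \<in> cycle_edges q \<longleftrightarrow> u = a \<or> u = b"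
      using cycle_edges_neighbours[OF q(1,2) x] by metis
    obtain a' b' where ab': "\<And>u. {x, u} \<in> cycle_edges xs \<longleftrightarrow> u = a' \<or> u = b'"
      using cycle_edges_neighbours[of xs x] dist xs_len x qx by (metis distinct_append subsetD)
    have "{x, a} \<in> cycle_edges q" "{x, b} \<in> cycle_edges q" using ab(2) by simp_all
    then have "{x, a} \<in> cycle_edges xs" "{x, b} \<in> cycle_edges xs" using sub by auto
    then show ?thesis using ab ab' u by metis
  qed
  have "hd q \<in> set q" "hd q \<in> set xs" using q_ne qx by auto
  then show xq: "set xs \<subseteq> set q"
  proof (intro path_edges_closed[of "hd q" xs "set q"])
    fix a b assume "{a, b} \<in> path_edges xs" "a \<in> set q"
    then show "b \<in> set q"
      using nb[of a b] cycle_edges_subset[OF q_ne] by (auto simp: cycle_edges_def)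
  qed
  show "cycle_edges xs \<subseteq> cycle_edges q"
  proof
    fix f assume f: "f \<in> cycle_edges xs"
    then have "\<exists>x u. f = {x, u}" by (auto simp: cycle_edges_def path_edges_def)
    then obtain x u where "f = {x, u}" by blast
    moreover from this have "x \<in> set q" using f cycle_edges_subset[OF xs_ne] xq by blast
    ultimately show "f \<in> cycle_edges q" using nb f by simp
  qed
qed

section \<open>Lower bound for closed tours\<close>

lemma bridge_crossed_twice:
  assumes w: "hd w = last w" "set w = V" "path_edges w \<subseteq> E'"
    and S: "x \<in> V" "x \<in> S" "y \<in> V" "y \<notin> S"
    and cut: "\<And>a b. {a, b} \<in> E' \<Longrightarrow> a \<in> S \<Longrightarrow> b \<notin> S \<Longrightarrow> {a, b} = f"
  shows "2 \<le> card {i \<in> {..<length w - 1}. {w ! i, w ! Suc i} = f}"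
proof -
  obtain i k where ik: "Suc i < length w" "w ! i \<in> S" "w ! Suc i \<notin> S"
    "Suc k < length w" "w ! k \<notin> S" "w ! Suc k \<in> S"
    using closed_walk_crosses_twice[OF w(1), of x S y] S w(2) by metis
  have "{w ! i, w ! Suc i} \<in> E'" "{w ! Suc k, w ! k} \<in> E'"
    using w(3) nth_path_edges[OF ik(1)] nth_path_edges[OF ik(4)] by (auto simp: insert_commute)
  then have "{w ! i, w ! Suc i} = f" "{w ! k, w ! Suc k} = f"
    using cut ik by (metis insert_commute)+
  then have "{i, k} \<subseteq> {i \<in> {..<length w - 1}. {w ! i, w ! Suc i} = f}"
    using ik by auto
  moreover have "i \<noteq> k" using ik by auto
  ultimately show ?thesis
    using card_mono[of "{i \<in> {..<length w - 1}. {w ! i, w ! Suc i} = f}" "{i, k}"] by simp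
qed

text \<open>Such an edge is a bridge, cutting off the part of the stem beyond it.\<close>

lemma stem_crossed_twice:
  assumes w: "hd w = last w" "set w = V" "path_edges w \<subseteq> E"
    and f: "f \<in> E - cycle_edges xs"
  shows "2 \<le> card {i \<in> {..<length w - 1}. {w ! i, w ! Suc i} = f}"
proof -
  have hx: "hd xs \<in> set xs" "hd ys \<in> set ys" using xs_ne ys_ne by auto
  have disj: "set xs \<inter> set ys = {}" using dist by auto
  consider "f \<in> path_edges ys" | "f = {j, hd ys}" using f by (auto simp: E)
  then show ?thesis
  proof cases
    case 1
    then obtain as bs where ys: "ys = as @ bs" "as \<noteq> []" "bs \<noteq> []" "f = {last as, hd bs}"
      by (rule path_edges_split)
    have d: "distinct (as @ bs)" using dist ys by simp
    have b: "hd bs \<in> set bs" "hd as \<in> set as" using ys by auto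
    show ?thesis
    proof (rule bridge_crossed_twice[OF w, of "hd bs" "set bs" "hd xs"])
      fix a b assume ab: "{a, b} \<in> E" "a \<in> set bs" "b \<notin> set bs"
      have "{a, b} \<notin> cycle_edges xs" "{a, b} \<notin> path_edges as" "{a, b} \<notin> path_edges bs"
        using cycle_edges_subset[OF xs_ne, of "{a, b}"] path_edges_subset[of "{a, b}"] ab(2,3) d disj ys(1)
        by auto
      moreover have "hd ys \<notin> set bs" using b(2) d ys(1,2) by (metis disjoint_iff distinct_append hd_append2)
      then have "{a, b} \<noteq> {j, hd ys}"
        using ab(2) disj ys(1) j by (auto simp: doubleton_eq_iff)
      ultimately show "{a, b} = f" using ab(1) ys by (auto simp: E path_edges_append)
    qed (use ys b hx disj in auto)
  next
    case 2
    show ?thesis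
    proof (rule bridge_crossed_twice[OF w, of "hd ys" "set ys" "hd xs"])
      fix a b assume ab: "{a, b} \<in> E" "a \<in> set ys" "b \<notin> set ys"
      have "{a, b} \<notin> cycle_edges xs" "{a, b} \<notin> path_edges ys"
        using cycle_edges_subset[OF xs_ne, of "{a, b}"] path_edges_subset[of "{a, b}"] ab(2,3) disj
        by auto
      then show "{a, b} = f" using ab(1) 2 by (auto simp: E)
    qed (use hx disj in auto)
  qed
qed

text \<open>With the closing edge gone a tree is left, so the other cycle edges become
  bridges.\<close>

lemma cycle_path_crossed_twice:
  assumes w: "hd w = last w" "set w = V" "path_edges w \<subseteq> E - {{last xs, hd xs}}"
    and f: "f \<in> path_edges xs"
  shows "2 \<le> card {i \<in> {..<length w - 1}. {w ! i, w ! Suc i} = f}"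
proof -
  have disj: "set xs \<inter> set ys = {}" using dist by auto
  have hy: "hd ys \<in> set ys" using ys_ne by auto
  obtain as bs where xs: "xs = as @ bs" "as \<noteq> []" "bs \<noteq> []" "f = {last as, hd bs}"
    using f by (rule path_edges_split)
  have d: "set as \<inter> set bs = {}" using dist xs by auto
  have hab: "hd as \<in> set as" "hd bs \<in> set bs" using xs by auto
  \<comment> \<open>The piece without the junction is taken, so that the edge to the stem does not
    leave it.\<close>
  define S where "S = (if j \<in> set as then set bs else set as)"
  have S: "S = set as \<or> S = set bs" "j \<notin> S" using d by (auto simp: S_def)
  have "S \<noteq> {}" "S \<subseteq> V" using S(1) hab xs(1) by auto
  then obtain x where x: "x \<in> S" "x \<in> V" by blast
  show ?thesis
  proof (rule bridge_crossed_twice[OF w, of x S j])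
    fix a b assume ab: "{a, b} \<in> E - {{last xs, hd xs}}" "a \<in> S" "b \<notin> S"
    have a: "a \<in> set xs" using S ab xs by auto
    have "{a, b} \<noteq> {j, hd ys}" using ab S a disj hy by (auto simp: doubleton_eq_iff)
    moreover have "{a, b} \<notin> path_edges ys"
      using path_edges_subset[of "{a, b}" ys] a disj by auto
    moreover have "{a, b} \<notin> path_edges as" "{a, b} \<notin> path_edges bs"
      using path_edges_subset[of "{a, b}" as] path_edges_subset[of "{a, b}" bs] S ab(2,3) d by auto
    ultimately show "{a, b} = f" using ab(1) xs unfolding E_minus_closing_edge
      by (auto simp: path_edges_append)
  qed (use x S j in auto)
qed

text \<open>Crossing each cycle edge at least once and every other edge twice gives the first bound.
  If some cycle edge is never crossed, it can be listed as the closing edge, and all others are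
  crossed twice.\<close>

lemma tour_cost_lower_bound:
  fixes c :: "'v set \<Rightarrow> real"
  assumes c: "\<And>f. f \<in> E \<Longrightarrow> 0 \<le> c f"
    and w: "hd w = last w" "set w = V" "path_edges w \<subseteq> E"
  shows "2 * sum c E - sum c (cycle_edges xs) \<le> (\<Sum>i<length w - 1. c {w ! i, w ! Suc i}) \<or>
    (\<exists>e \<in> cycle_edges xs. 2 * (sum c E - c e) \<le> (\<Sum>i<length w - 1. c {w ! i, w ! Suc i}))"
proof -
  define n where "n f = card {i \<in> {..<length w - 1}. {w ! i, w ! Suc i} = f}" for f
  have "(\<lambda>i. {w ! i, w ! Suc i}) ` {..<length w - 1} \<subseteq> E"
    using w(3) nth_path_edges[of _ w] by auto
  then have cost: "(\<Sum>i<length w - 1. c {w ! i, w ! Suc i}) = (\<Sum>f\<in>E. real (n f) * c f)"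
    unfolding n_def using finite_E by (intro sum_fun_comp) auto
  have CE: "cycle_edges xs \<subseteq> E" by (auto simp: E)
  have stem: "2 \<le> n f" if "f \<in> E - cycle_edges xs" for f
    unfolding n_def using stem_crossed_twice[OF w that] .
  show ?thesis
  proof (cases "\<forall>e \<in> cycle_edges xs. 1 \<le> n e")
    case True
    have "2 * sum c E - sum c (cycle_edges xs) = 2 * sum c (E - cycle_edges xs) + sum c (cycle_edges xs)"
      using finite_E CE by (simp add: sum_diff)
    also have "\<dots> = (\<Sum>f\<in>E - cycle_edges xs. 2 * c f) + (\<Sum>f\<in>cycle_edges xs. 1 * c f)"
      by (simp add: sum_distrib_left)
    also have "\<dots> \<le> (\<Sum>f\<in>E - cycle_edges xs. real (n f) * c f) + (\<Sum>f\<in>cycle_edges xs. real (n f) * c f)"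
      using stem True c CE by (intro add_mono sum_mono mult_right_mono) force+
    also have "\<dots> = (\<Sum>f\<in>E. real (n f) * c f)"
      using finite_E CE by (simp add: sum.subset_diff)
    finally show ?thesis unfolding cost by (rule disjI1)
  next
    case False
    then obtain e where e: "e \<in> cycle_edges xs" "n e = 0" by (auto simp: not_le)
    have we: "path_edges w \<subseteq> E - {e}"
    proof -
      have "e \<notin> path_edges w"
      proof
        assume "e \<in> path_edges w"
        then obtain i where "e = {w ! i, w ! Suc i}" "Suc i < length w"
          unfolding path_edges_def by blast
        then have "i \<in> {i \<in> {..<length w - 1}. {w ! i, w ! Suc i} = e}" by auto
        then have "0 < n e" unfolding n_def by (subst card_gt_0_iff) auto
        then show False using e by simp
      qed
      then show ?thesis using w(3) by blast
    qed
    obtain xs' where xs': "tadpole_rep xs' ys j E" "cycle_edges xs' = cycle_edges xs"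
      "set xs' = set xs" "e = {last xs', hd xs'}"
      using rotated[OF e(1)] by blast
    have "2 \<le> n f" if "f \<in> E - {e}" for f
    proof (cases "f \<in> cycle_edges xs")
      case True
      then have "f \<in> path_edges xs'" using that xs'(4) unfolding xs'(2)[symmetric] by (simp add: cycle_edges_def)
      then show ?thesis
        using tadpole_rep.cycle_path_crossed_twice[OF xs'(1) w(1)] w(2) we xs'(3,4)
        unfolding n_def by simp
    qed (use stem that in auto)
    then have "(\<Sum>f\<in>E - {e}. 2 * c f) \<le> (\<Sum>f\<in>E - {e}. real (n f) * c f)"
      using c by (intro sum_mono mult_right_mono) force+
    also have "\<dots> = (\<Sum>f\<in>E. real (n f) * c f)"
      using finite_E e CE by (simp add: sum_diff1 subsetD)
    finally have "2 * (sum c E - c e) \<le> (\<Sum>f\<in>E. real (n f) * c f)"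
      using e CE finite_E by (simp add: sum_distrib_left[symmetric] sum_diff1 subsetD)
    then show ?thesis unfolding cost using e(1) by blast
  qed
qed

section \<open>Upper bounds for the two strategies\<close>

lemma nbrs_subset: "nbrs E v \<subseteq> V - {v}"
  using edge_subset no_loop by (auto simp: nbrs_def)

text \<open>For the termination measure, with \<open>n\<close> the stack height: a push raises the
  height by one, which the factor two pays for. All other moves lower the height.\<close>

lemma measure_push:
  "u \<in> V \<Longrightarrow> u \<notin> set r \<Longrightarrow>
   2 * card (V - set (u # r)) + Suc n < 2 * card (V - set r) + n"
proof -
  assume u: "u \<in> V" "u \<notin> set r"
  then have "card (V - set (u # r)) < card (V - set r)" by (intro psubset_card_mono) auto
  then show ?thesis by simp
qed

text \<open>Amortisation: the cost so far plus the cost of going home along the stack is twice the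
  weight of the edges by which vertices were discovered.\<close>

lemma tree_exploration:
  fixes c :: "'v set \<Rightarrow> real"
  assumes e: "e \<in> cycle_edges xs" and s: "s \<in> V" and c: "\<And>f. f \<in> E \<Longrightarrow> 0 \<le> c f"
  obtains r where "follows (tree_act (\<lambda>_ f. f = e) (nbrs E)) s r"
    "tree_act (\<lambda>_ f. f = e) (nbrs E) r = None"
    "hd r = s" "last r = s" "path_edges r \<subseteq> E" "set r = V" "path_cost c r \<le> 2 * (sum c E - c e)"
proof -
  let ?P = "\<lambda>_ f. f = e" and ?N = "nbrs E"
  \<comment> \<open>\<open>U\<close> collects the discovery edges. Confining them to visited
    vertices makes each new one distinct from all earlier ones.\<close>
  define K where "K r U \<longleftrightarrow> U \<subseteq> E - {e} \<and> \<Union>U \<subseteq> set r \<and>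
    path_cost c r + path_cost c (dfs_stack r) = 2 * sum c U" for r U
  define I where "I r \<longleftrightarrow> dfs_inv (E - {e}) s r \<and> set r \<subseteq> V \<and> (\<exists>U. K r U)" for r
  define C where "C r = {u \<in> fresh ?N r. {hd r, u} \<notin> skipped ?P ?N r}" for r
  have act: "tree_act ?P ?N r = (if C r \<noteq> {} then Some (SOME u. u \<in> C r) else backtrack r)" for r
    unfolding tree_act_def C_def Let_def by (rule refl)
  have visited: "u \<in> set r" if "C r = {}" "{hd r, u} \<in> E - {e}" for r u
    using that skipped_edge_subset[of e ?N r] by (auto simp: C_def fresh_def nbrs_def)
  have chosen: "u \<notin> set r \<and> {hd r, u} \<in> E - {e}"
    if "C r \<noteq> {}" "u = (SOME u. u \<in> C r)" "r \<noteq> []" for r u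
  proof -
    have u: "u \<in> C r" using that some_in_eq by blast
    \<comment> \<open>While nothing has been skipped, the choice cannot be \<open>e\<close>, since
      that would have triggered the test; afterwards \<open>C r\<close> excludes it.\<close>
    have "{hd r, u} \<noteq> e"
    proof (cases "skipped ?P ?N r = {}")
      case True
      then have fr: "C r = fresh ?N r" by (simp add: C_def)
      obtain v r' where r: "r = v # r'" using \<open>r \<noteq> []\<close> by (cases r) auto
      have "fresh ?N r \<noteq> {} \<Longrightarrow> {v, SOME u. u \<in> fresh ?N r} \<noteq> e"
        using True unfolding r by (auto split: if_splits)
      then show ?thesis using that fr r by simp
    next
      case False
      then have "skipped ?P ?N r = {e}" using skipped_edge_subset[of e ?N r] by auto
      then show ?thesis using u by (auto simp: C_def)
    qed
    then show ?thesis using u by (auto simp: C_def fresh_def nbrs_def)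
  qed
  have "I [s]" unfolding I_def using s by (intro conjI exI[of _ "{}"]) (auto simp: dfs_inv_start K_def)
  moreover have "I (u # r) \<and> 2 * card (V - set (u # r)) + length (dfs_stack (u # r))
      < 2 * card (V - set r) + length (dfs_stack r)"
    if step: "I r" "tree_act ?P ?N r = Some u" "r \<noteq> []" for r u
  proof -
    have inv: "dfs_inv (E - {e}) s r" and rV: "set r \<subseteq> V" using that(1) by (auto simp: I_def)
    obtain U where KU: "K r U" using step(1) by (auto simp: I_def)
    then have U: "U \<subseteq> E - {e}" "\<Union>U \<subseteq> set r"
      "path_cost c r + path_cost c (dfs_stack r) = 2 * sum c U"
      by (simp_all add: K_def)
    have fU: "finite U" using U(1) finite_E finite_subset by auto
    have st: "dfs_stack r \<noteq> []" "hd (dfs_stack r) = hd r" using inv by (auto simp: dfs_inv_def)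
    show ?thesis
    proof (cases "C r = {}")
      case False
      then have u: "u \<notin> set r" "{hd r, u} \<in> E - {e}"
        using that(2) chosen[of r u] \<open>r \<noteq> []\<close> by (auto simp: act)
      have uV: "u \<in> V" using u edge_subset by blast
      note push = dfs_inv_push[OF inv u(2,1)]
      have "{hd r, u} \<notin> U" using u U(2) by blast
      moreover have "path_cost c (u # r) + path_cost c (u # dfs_stack r)
          = path_cost c r + path_cost c (dfs_stack r) + 2 * c {hd r, u}"
        using st \<open>r \<noteq> []\<close> by (simp add: path_cost_Cons insert_commute)
      ultimately have "path_cost c (u # r) + path_cost c (u # dfs_stack r)
          = 2 * sum c (insert {hd r, u} U)"
        using fU U(3) by simp
      moreover have "insert {hd r, u} U \<subseteq> E - {e}" "\<Union>(insert {hd r, u} U) \<subseteq> set (u # r)"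
        using U u \<open>r \<noteq> []\<close> by auto
      ultimately have "K (u # r) (insert {hd r, u} U)" unfolding K_def push(2) by blast
      then have "I (u # r)" unfolding I_def using push(1) rV uV by auto
      then show ?thesis
        unfolding push(2) using measure_push[OF uV u(1), of "length (dfs_stack r)"] by simp
    next
      case True
      then have "backtrack r = Some u" using that(2) by (simp add: act)
      then obtain bs where bs: "dfs_stack r = [hd r] @ u # bs"
        using st by (cases "dfs_stack r"; cases "tl (dfs_stack r)") (auto simp: backtrack_def)
      then have hu: "{hd r, u} \<in> E - {e}" using inv by (auto simp: dfs_inv_def)
      note bk = dfs_inv_back[OF inv bs hu]
      have bk': "dfs_inv (E - {e}) s (u # r)" "dfs_stack (u # r) = u # bs"
        using bk visited[OF True] by auto
      have ur: "set (u # r) = set r" using inv bs by (auto simp: dfs_inv_def)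
      have "path_cost c (u # r) + path_cost c (u # bs) = path_cost c r + path_cost c (dfs_stack r)"
        using \<open>r \<noteq> []\<close> unfolding bs by (simp add: path_cost_Cons insert_commute)
      then have "K (u # r) U" unfolding K_def bk'(2) ur using U by simp
      then have "I (u # r)" unfolding I_def ur using bk'(1) rV by auto
      then show ?thesis unfolding bk'(2) ur bs by simp
    qed
  qed
  ultimately obtain r where r: "follows (tree_act ?P ?N) s r" "tree_act ?P ?N r = None" "I r"
    by (rule run_terminates)
  have inv: "dfs_inv (E - {e}) s r" and rV: "set r \<subseteq> V" using r(3) by (auto simp: I_def)
  have Ce: "C r = {}" "tl (dfs_stack r) = []"
    using r(2) by (auto simp: act backtrack_def split: if_splits)
  note fin = dfs_inv_final[OF inv Ce(2) visited[OF Ce(1)]]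
  have "V \<subseteq> set r" using connected_minus[OF e s fin(3)] fin(4) by blast
  moreover have "path_cost c r \<le> 2 * (sum c E - c e)"
  proof -
    obtain U where "K r U" using r(3) by (auto simp: I_def)
    then have U: "U \<subseteq> E - {e}" "path_cost c r + path_cost c (dfs_stack r) = 2 * sum c U"
      by (simp_all add: K_def)
    have "sum c U \<le> sum c (E - {e})" using U(1) finite_E c by (intro sum_mono2) auto
    also have "\<dots> = sum c E - c e" using e finite_E by (simp add: sum_diff1 E)
    finally show ?thesis using U(2) fin(1) by simp
  qed
  ultimately show thesis
    using that[OF r(1,2) fin(2)] inv rV by (auto simp: dfs_inv_def)
qed

text \<open>The balance of the tree search holds until the cycle is closed. Then the stack segment
  around the cycle is discarded, so that it need not be retraced.\<close>

lemma cycle_exploration: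
  fixes c :: "'v set \<Rightarrow> real"
  assumes k: "enumeration (nbrs E j) ! k = hd ys" and s: "s \<in> V" and c: "\<And>f. f \<in> E \<Longrightarrow> 0 \<le> c f"
  obtains r where "follows (cycle_act k (nbrs E)) s r" "cycle_act k (nbrs E) r = None"
    "hd r = s" "last r = s" "path_edges r \<subseteq> E" "set r = V"
    "path_cost c r \<le> 2 * sum c E - sum c (cycle_edges xs)"
proof -
  let ?N = "nbrs E"
  \<comment> \<open>\<open>D r\<close> is nonempty exactly once the cycle has been closed; before
    that, no cycle vertex leaves the stack.\<close>
  define D where "D r = (set r - set (dfs_stack r)) \<inter> set xs" for r
  \<comment> \<open>Before closing, an edge of \<open>U\<close> with both ends on the stack is a
    stack edge; this later shows that the closing edge is new. After closing, the inequality records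
    the saving.\<close>
  define K where "K r U \<longleftrightarrow> (if D r = {}
    then (\<forall>f \<in> U. f \<in> path_edges (dfs_stack r) \<or> \<not> f \<subseteq> set (dfs_stack r)) \<and>
      path_cost c r + path_cost c (dfs_stack r) = 2 * sum c U
    else path_cost c r + path_cost c (dfs_stack r) \<le> 2 * sum c U - sum c (cycle_edges xs))" for r U
  \<comment> \<open>The third conjunct says that the junction is not left before the stem has been
    entered.\<close>
  define I where "I r \<longleftrightarrow> dfs_inv E s r \<and> set r \<subseteq> V \<and> (j \<in> set r \<longrightarrow> hd r = j \<or> hd ys \<in> set r) \<and>
    (\<exists>U \<subseteq> E. \<Union>U \<subseteq> set r \<and> K r U)" for r
  have hy: "hd ys \<in> ?N j" by (simp add: nbrs_def E)
  have visited: "u \<in> set r" if "fresh ?N r = {}" "{hd r, u} \<in> E" for r u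
    using that by (auto simp: fresh_def nbrs_def)
  have cnb: "\<exists>a b. a \<noteq> b \<and> a \<noteq> x \<and> b \<noteq> x \<and> {x, a} \<in> E \<and> {x, b} \<in> E \<and> a \<in> set xs \<and> b \<in> set xs"
    if x: "x \<in> set xs" for x
  proof -
    obtain a b where ab: "a \<noteq> b" "a \<noteq> x" "b \<noteq> x" "\<And>u. {x, u} \<in> cycle_edges xs \<longleftrightarrow> u = a \<or> u = b"
      using cycle_edges_neighbours[of xs x] dist xs_len x by (metis distinct_append)
    have "{x, a} \<in> cycle_edges xs" "{x, b} \<in> cycle_edges xs" using ab(4) by simp_all
    then show ?thesis using ab(1-3) unfolding cycle_edge_iff by blast
  qed
  have "I [s]"
    unfolding I_def using s by (intro conjI exI[of _ "{}"]) (auto simp: dfs_inv_start K_def D_def)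
  moreover have "I (u # r) \<and> 2 * card (V - set (u # r)) + length (dfs_stack (u # r))
      < 2 * card (V - set r) + length (dfs_stack r)"
    if step: "I r" "cycle_act k ?N r = Some u" "r \<noteq> []" for r u
  proof -
    have inv: "dfs_inv E s r" and rV: "set r \<subseteq> V" and J: "j \<in> set r \<longrightarrow> hd r = j \<or> hd ys \<in> set r"
      using that(1) by (auto simp: I_def)
    obtain U where U: "U \<subseteq> E" "\<Union>U \<subseteq> set r" "K r U"
      using step(1) unfolding I_def by blast
    have fU: "finite U" using U(1) finite_E finite_subset by auto
    have st: "dfs_stack r \<noteq> []" "hd (dfs_stack r) = hd r" "distinct (dfs_stack r)"
      "set (dfs_stack r) \<subseteq> set r" "path_edges (dfs_stack r) \<subseteq> E"
      using inv by (auto simp: dfs_inv_def)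
    consider (push) "fresh ?N r \<noteq> {}" | (close) "fresh ?N r = {}" "set (drop 2 (dfs_stack r)) \<inter> ?N (hd r) \<noteq> {}"
      | (pop) "fresh ?N r = {}" "set (drop 2 (dfs_stack r)) \<inter> ?N (hd r) = {}" by blast
    then show ?thesis
    proof cases
      case push
      have u_def: "u = pick k (?N (hd r)) (fresh ?N r)" using that(2) push by (simp add: cycle_act_def)
      then have "u \<in> fresh ?N r" using pick_in[OF push] by metis
      then have u: "u \<notin> set r" "{hd r, u} \<in> E" by (auto simp: fresh_def nbrs_def)
      have uV: "u \<in> V" using u edge_subset by blast
      note ps = dfs_inv_push[OF inv u(2,1)]
      have J': "j \<in> set (u # r) \<longrightarrow> hd (u # r) = j \<or> hd ys \<in> set (u # r)"
      proof (cases "hd r = j \<and> hd ys \<notin> set r")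
        case True
        then have "hd ys \<in> fresh ?N r" using hy by (simp add: fresh_def)
        \<comment> \<open>Here the advice acts: the preferred neighbour of the junction is the
          stem.\<close>
        then have "u = hd ys" using u_def k True by (simp add: pick_def)
        then show ?thesis by simp
      qed (use J in auto)
      have D: "D (u # r) = D r" using u(1) unfolding D_def ps(2) by auto
      have new: "{hd r, u} \<notin> U" using u U(2) by blast
      have cost: "path_cost c (u # r) + path_cost c (u # dfs_stack r)
          = path_cost c r + path_cost c (dfs_stack r) + 2 * c {hd r, u}"
        using st \<open>r \<noteq> []\<close> by (simp add: path_cost_Cons insert_commute)
      have "K (u # r) (insert {hd r, u} U)"
      proof -
        have "f \<in> path_edges (u # dfs_stack r) \<or> \<not> f \<subseteq> set (u # dfs_stack r)"
          if "f \<in> insert {hd r, u} U" "\<forall>f \<in> U. f \<in> path_edges (dfs_stack r) \<or> \<not> f \<subseteq> set (dfs_stack r)" for f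
        proof (cases "f = {hd r, u}")
          case True
          then show ?thesis using st by (simp add: path_edges_Cons insert_commute)
        next
          case False
          then have "f \<in> U" using that(1) by simp
          then have "u \<notin> f" using U(2) u(1) by blast
          then show ?thesis using that(2) \<open>f \<in> U\<close> st(1) by (auto simp: path_edges_Cons)
        qed
        then show ?thesis
          using U(3) cost new fU unfolding K_def D ps(2) by (auto split: if_splits)
      qed
      moreover have "insert {hd r, u} U \<subseteq> E" "\<Union>(insert {hd r, u} U) \<subseteq> set (u # r)"
        using U u \<open>r \<noteq> []\<close> by auto
      ultimately have "I (u # r)"
        unfolding I_def using ps(1) rV uV J' by (intro conjI exI[of _ "insert {hd r, u} U"]) auto
      then show ?thesis
        unfolding ps(2) using measure_push[OF uV u(1), of "length (dfs_stack r)"] by simp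
    next
      case pop
      then have "backtrack r = Some u" using that(2) by (simp add: cycle_act_def)
      then obtain bs where bs: "dfs_stack r = [hd r] @ u # bs"
        using st by (cases "dfs_stack r"; cases "tl (dfs_stack r)") (auto simp: backtrack_def)
      then have hu: "{hd r, u} \<in> E" using st(5) by auto
      have bk: "dfs_inv E s (u # r)" "dfs_stack (u # r) = u # bs"
        using dfs_inv_back[OF inv bs hu] visited[OF pop(1)] by auto
      have ur: "set (u # r) = set r" using st(4) bs by auto
      have J': "j \<in> set (u # r) \<longrightarrow> hd (u # r) = j \<or> hd ys \<in> set (u # r)"
        using J visited[OF pop(1), of "hd ys"] hy unfolding ur by (auto simp: nbrs_def)
      have cost: "path_cost c (u # r) + path_cost c (u # bs) = path_cost c r + path_cost c (dfs_stack r)"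
        using \<open>r \<noteq> []\<close> unfolding bs by (simp add: path_cost_Cons insert_commute)
      have D: "D (u # r) = D r \<union> ({hd r} \<inter> set xs)"
        using st(3,4) unfolding D_def bk(2) ur bs by auto
      \<comment> \<open>Without fresh neighbours, both cycle neighbours of a cycle vertex would be
        on the stack, and the one not directly below it would allow a closing move instead of a
        pop.\<close>
      have stay: "hd r \<notin> set xs" if "D r = {}"
      proof
        assume "hd r \<in> set xs"
        then obtain a b where ab: "a \<noteq> b" "a \<noteq> hd r" "b \<noteq> hd r" "{hd r, a} \<in> E" "{hd r, b} \<in> E"
          "a \<in> set xs" "b \<in> set xs" using cnb by blast
        then have "a \<in> set (dfs_stack r)" "b \<in> set (dfs_stack r)"
          using visited[OF pop(1)] \<open>D r = {}\<close> by (auto simp: D_def)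
        then have "a \<in> set bs \<or> b \<in> set bs" using ab(1-3) bs by auto
        then show False using pop(2) ab(4,5) unfolding bs by (auto simp: nbrs_def)
      qed
      have "K (u # r) U"
      proof (cases "D r = {}")
        case True
        have "f \<in> path_edges (u # bs) \<or> \<not> f \<subseteq> set (u # bs)"
          if "f \<in> path_edges (dfs_stack r) \<or> \<not> f \<subseteq> set (dfs_stack r)" for f
          using that st(3) unfolding bs by auto
        then show ?thesis
          using U(3) True stay cost unfolding K_def D bk(2) by auto
      next
        case False
        then show ?thesis using U(3) cost unfolding K_def D bk(2) by auto
      qed
      then have "I (u # r)" unfolding I_def ur using bk(1) rV J' U unfolding ur by auto
      then show ?thesis unfolding bk(2) ur bs by simp
    next
      case close
      then have "u = (SOME u. u \<in> set (drop 2 (dfs_stack r)) \<inter> ?N (hd r))"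
        using that(2) by (simp add: cycle_act_def)
      then have "u \<in> set (drop 2 (dfs_stack r)) \<inter> ?N (hd r)"
        using close(2) some_in_eq by blast
      then have u: "u \<in> set (drop 2 (dfs_stack r))" and hu: "{hd r, u} \<in> E" by (auto simp: nbrs_def)
      obtain p rest where rest: "dfs_stack r = hd r # p # rest"
        using st(1,2) u by (cases "dfs_stack r"; cases "tl (dfs_stack r)") auto
      then have "u \<in> set rest" using u by simp
      then obtain as bs where ab: "rest = as @ u # bs" by (meson split_list)
      \<comment> \<open>The stack from the current vertex down to \<open>u\<close>, closed by the
        edge back to \<open>hd r\<close>, is a simple cycle and hence covers the cycle of the
        tadpole.\<close>
      define q where "q = hd r # p # as @ [u]"
      have stk: "dfs_stack r = (hd r # p # as) @ u # bs" using rest ab by simp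
      have "path_edges q \<subseteq> path_edges (dfs_stack r)"
        using path_edges_append[of q bs] unfolding stk by (cases "bs = []") (auto simp: q_def)
      then have "cycle_edges q \<subseteq> E"
        using hu st(5) by (auto simp: q_def cycle_edges_def insert_commute)
      moreover have "distinct q" using st(3) unfolding stk q_def by auto
      ultimately have q: "set q \<subseteq> set xs" "cycle_edges xs \<subseteq> cycle_edges q" "set xs \<subseteq> set q"
        using simple_cycle_covers[of q] by (auto simp: q_def)
      have qst: "set q \<subseteq> set (dfs_stack r)" by (auto simp: q_def stk)
      \<comment> \<open>All cycle vertices are on the stack, hence visited. The only other possible
        neighbour is \<open>hd ys\<close>, visited by the invariant or because nothing is fresh at
        the current vertex.\<close>
      have finished: "z \<in> set r" if x: "x \<in> set (hd r # p # as)" and z: "{x, z} \<in> E" for x z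
      proof -
        have xx: "x \<in> set xs" using x q(1) by (auto simp: q_def)
        then have xr: "x \<in> set r" using q(3) qst st(4) by blast
        show ?thesis
        proof (cases "z \<in> set xs")
          case True
          then show ?thesis using q(3) qst st(4) by blast
        next
          case False
          have "{x, z} \<notin> path_edges ys" using path_edges_subset[of "{x, z}" ys] xx dist by auto
          moreover have "{x, z} \<notin> cycle_edges xs"
            using cycle_edges_subset[OF xs_ne, of "{x, z}"] False by auto
          ultimately have "{x, z} = {j, hd ys}" using z unfolding E by blast
          then have "x = j" "z = hd ys" using False j by (auto simp: doubleton_eq_iff)
          then show ?thesis using J xr visited[OF close(1), of z] z by auto
        qed
      qed
      have bk: "dfs_inv E s (u # r)" "dfs_stack (u # r) = u # bs"
        using dfs_inv_back[OF inv stk hu] finished by blast+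
      have ur: "set (u # r) = set r" using st(4) stk by auto
      have J': "j \<in> set (u # r) \<longrightarrow> hd (u # r) = j \<or> hd ys \<in> set (u # r)"
        using J visited[OF close(1), of "hd ys"] hy unfolding ur by (auto simp: nbrs_def)
      have D0: "D r = {}" using q(3) qst by (auto simp: D_def)
      have "p \<in> D (u # r)"
        using st(3,4) q(1) unfolding D_def bk(2) ur stk by (auto simp: q_def)
      then have D1: "D (u # r) \<noteq> {}" by blast
      \<comment> \<open>An old edge would have to be a stack edge, but the stack continues from
        \<open>hd r\<close> to \<open>p\<close>, and \<open>u\<close> lies deeper.\<close>
      have new: "{hd r, u} \<notin> U"
      proof
        assume "{hd r, u} \<in> U"
        moreover have "{hd r, u} \<subseteq> set (dfs_stack r)" by (simp add: stk)
        ultimately have "{hd r, u} \<in> path_edges (dfs_stack r)" using U(3) D0 by (auto simp: K_def)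
        then have "{hd r, u} = {hd r, p} \<or> {hd r, u} \<in> path_edges (p # rest)"
          using rest by simp
        moreover have "hd r \<notin> set (p # rest)" "u \<noteq> p" using st(3) \<open>u \<in> set rest\<close> unfolding rest by auto
        ultimately show False using path_edges_subset[of "{hd r, u}" "p # rest"]
          by (auto simp: doubleton_eq_iff)
      qed
      \<comment> \<open>The discarded segment and the closing edge together weigh at least as much
        as the cycle, which is exactly the saving claimed.\<close>
      have "sum c (cycle_edges xs) \<le> sum c (cycle_edges q)"
        using q(2) \<open>cycle_edges q \<subseteq> E\<close> c by (intro sum_mono2) auto
      also have "\<dots> \<le> c {hd r, u} + sum c (path_edges q)"
      proof -
        have "cycle_edges q = insert {hd r, u} (path_edges q)"
          by (simp add: cycle_edges_def q_def insert_commute[of u])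
        then show ?thesis using c[OF hu] by (simp add: sum.insert_if)
      qed
      also have "sum c (path_edges q) \<le> path_cost c q"
        using \<open>cycle_edges q \<subseteq> E\<close> c by (intro path_cost_ge_sum) (auto simp: cycle_edges_def)
      finally have seg: "sum c (cycle_edges xs) \<le> c {hd r, u} + path_cost c q" by simp
      have "path_cost c (dfs_stack r) = path_cost c q + path_cost c (u # bs)"
        unfolding stk q_def using path_cost_append[of c "hd r # p # as" u bs] by simp
      then have "path_cost c (u # r) + path_cost c (u # bs)
          = path_cost c r + path_cost c (dfs_stack r) + c {hd r, u} - path_cost c q"
        using \<open>r \<noteq> []\<close> by (simp add: path_cost_Cons insert_commute)
      also have "\<dots> \<le> 2 * sum c (insert {hd r, u} U) - sum c (cycle_edges xs)"
        using seg new fU U(3) D0 by (simp add: K_def)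
      finally have "K (u # r) (insert {hd r, u} U)" unfolding K_def bk(2) using D1 by simp
      moreover have "insert {hd r, u} U \<subseteq> E" "\<Union>(insert {hd r, u} U) \<subseteq> set (u # r)"
        using U hu \<open>r \<noteq> []\<close> by auto
      ultimately have "I (u # r)"
        unfolding I_def using bk(1) rV J' ur by (intro conjI exI[of _ "insert {hd r, u} U"]) auto
      then show ?thesis unfolding bk(2) ur stk by simp
    qed
  qed
  ultimately obtain r where r: "follows (cycle_act k ?N) s r" "cycle_act k ?N r = None" "I r"
    by (rule run_terminates)
  have inv: "dfs_inv E s r" and rV: "set r \<subseteq> V" using r(3) by (auto simp: I_def)
  have fr: "fresh ?N r = {}" "tl (dfs_stack r) = []"
    using r(2) by (auto simp: cycle_act_def backtrack_def split: if_splits)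
  note fin = dfs_inv_final[OF inv fr(2) visited[OF fr(1)]]
  have Vr: "V \<subseteq> set r" using connected[OF s fin(3)] fin(4) by blast
  have "path_cost c r \<le> 2 * sum c E - sum c (cycle_edges xs)"
  proof -
    obtain U where U: "U \<subseteq> E" "K r U" using r(3) unfolding I_def by blast
    \<comment> \<open>The stack has shrunk to \<open>s\<close>, while the cycle has at least three
      vertices, so it has been closed.\<close>
    have "\<not> set xs \<subseteq> {s}"
      using xs_len dist card_mono[of "{s}" "set xs"] by (auto simp: distinct_card)
    then have "D r \<noteq> {}" using Vr fin(1) by (auto simp: D_def)
    then have "path_cost c r \<le> 2 * sum c U - sum c (cycle_edges xs)"
      using U(2) fin(1) by (simp add: K_def)
    moreover have "sum c U \<le> sum c E" using U(1) finite_E c by (intro sum_mono2) auto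
    ultimately show ?thesis by simp
  qed
  then show thesis
    using that[OF r(1,2) fin(2)] inv rV Vr by (auto simp: dfs_inv_def)
qed

end

section \<open>Advice strings and optimality\<close>

lemma tadpole_iff:
  "tadpole G \<longleftrightarrow> (\<exists>xs ys j. tadpole_rep xs ys j (edges G) \<and> verts G = set xs \<union> set ys)"
proof -
  have "1 \<le> length ys \<longleftrightarrow> ys \<noteq> []" for ys :: "'a list" by (cases ys) auto
  then show ?thesis unfolding tadpole_def tadpole_rep_def by metis
qed

lemma completed_run_explorer:
  assumes "follows act s r" "act r = None" "r \<noteq> []" "path_edges r \<subseteq> edges G"
    and "\<And>q. q \<noteq> [] \<Longrightarrow> explorer adv (map (local_view G) (rev q)) = act q"
  shows "completed_run explorer adv G s (rev r)"
proof -
  have "partial_run explorer adv G s (rev r)"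
    using assms(1,4,5) by (rule partial_run_of_follows)
  then show ?thesis using assms(2) assms(5)[OF assms(3)] by (simp add: completed_run_def)
qed

lemma path_edges_rev: "path_edges (rev xs) = path_edges xs"
proof (induction xs)
  case (Cons x xs)
  then show ?case
    by (cases "xs = []") (simp_all add: path_edges_append path_edges_Cons last_rev insert_commute)
qed simp

text \<open>With \<open>L\<close> bits, \<open>n \<le> 2 ^ L\<close>, so \<open>k\<close> survives
  truncation to its lowest \<open>L\<close> bits.\<close>

lemma ex_bits:
  assumes "k < n"
  obtains bs where "length bs = nat \<lceil>log 2 (real n)\<rceil>" "horner_sum of_bool 2 bs = k"
proof -
  define L where "L = nat \<lceil>log 2 (real n)\<rceil>"
  have "real n = 2 powr log 2 (real n)" using assms by simp
  also have "\<dots> \<le> 2 powr real L" unfolding L_def by (intro powr_mono real_nat_ceiling_ge) auto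
  also have "\<dots> = real (2 ^ L)" by (simp add: powr_realpow)
  finally have "n \<le> 2 ^ L" by linarith
  then have "horner_sum of_bool 2 (map (bit k) [0..<L]) = k"
    using assms by (simp add: horner_sum_bit_eq_take_bit take_bit_nat_eq_self)
  then show thesis by (intro that[of "map (bit k) [0..<L]"]) (simp_all add: L_def)
qed

theorem theorem5:
  "\<exists>A :: 'v online_alg. \<forall>(G :: 'v wgraph) s.
     tadpole G \<and> positive_weights G \<and> s \<in> verts G \<longrightarrow>
     (\<exists>adv. length adv = nat \<lceil>log 2 (real (card (verts G)))\<rceil> + 1 \<and>
       (\<exists>w. completed_run A adv G s w \<and> exploration_tour G s w \<and>
            walk_cost G w = cost_opt G s))"
proof (intro exI[of _ explorer] allI impI)
  fix G :: "'v wgraph" and s :: 'v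
  assume asm: "tadpole G \<and> positive_weights G \<and> s \<in> verts G"
  then obtain xs ys j where "tadpole_rep xs ys j (edges G)" and V: "verts G = set xs \<union> set ys"
    unfolding tadpole_iff by blast
  then interpret tadpole_rep xs ys j "edges G" by simp
  let ?c = "weight G" and ?E = "edges G" and ?C = "cycle_edges xs"
  have c: "0 \<le> ?c f" if "f \<in> ?E" for f
    using asm that by (auto simp: positive_weights_def less_imp_le)
  have s: "s \<in> set xs \<union> set ys" using asm V by simp
  have C: "finite ?C" "?C \<noteq> {}" by (auto simp: cycle_edges_def)
  then have "Max (?c ` ?C) \<in> ?c ` ?C" by simp
  then obtain e where "e \<in> ?C" "?c e = Max (?c ` ?C)" by fastforce
  then have e: "e \<in> ?C" "\<And>f. f \<in> ?C \<Longrightarrow> ?c f \<le> ?c e" using C by auto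
  \<comment> \<open>As \<open>e\<close> is heaviest, the second term is the least of the bounds for
    tours avoiding a cycle edge, so \<open>M\<close> bounds every tour from below.\<close>
  define M where "M = min (2 * sum ?c ?E - sum ?c ?C) (2 * (sum ?c ?E - ?c e))"
  have lower: "M \<le> walk_cost G w" if w: "exploration_tour G s w" for w
  proof -
    have w': "hd w = last w" "set w = set xs \<union> set ys" "path_edges w \<subseteq> ?E"
      using w V by (auto simp: exploration_tour_def successively_iff_path_edges)
    show ?thesis
      using tour_cost_lower_bound[of ?c, OF c w'] e(2) unfolding M_def walk_cost_def by fastforce
  qed
  \<comment> \<open>Shared by both cases: a finished run of cost at most \<open>M\<close>, and a
    number below \<open>n\<close> that makes the explorer follow it, give the advice and an optimal
    tour.\<close>
  have *: "\<exists>adv. length adv = nat \<lceil>log 2 (real (card (verts G)))\<rceil> + 1 \<and>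
      (\<exists>w. completed_run explorer adv G s w \<and> exploration_tour G s w \<and> walk_cost G w = cost_opt G s)"
    if k: "k < card (verts G)"
      and act: "\<And>bs q. horner_sum of_bool 2 bs = k \<Longrightarrow> q \<noteq> [] \<Longrightarrow>
        explorer (b # bs) (map (local_view G) (rev q)) = act q"
      and r: "follows act s r" "act r = None" "hd r = s" "last r = s" "path_edges r \<subseteq> ?E"
        "set r = set xs \<union> set ys" "path_cost ?c r \<le> M" for k b act r
  proof -
    obtain bs where bs: "length bs = nat \<lceil>log 2 (real (card (verts G)))\<rceil>" "horner_sum of_bool 2 bs = k"
      using ex_bits[OF k] by blast
    have ne: "r \<noteq> []" using r(1) by auto
    have run: "completed_run explorer (b # bs) G s (rev r)"
      using completed_run_explorer[OF r(1,2) ne r(5)] act[OF bs(2)] by blast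
    have tour: "exploration_tour G s (rev r)"
      using r ne V by (simp add: exploration_tour_def successively_iff_path_edges path_edges_rev
          hd_rev last_rev)
    have "cost_opt G s = walk_cost G (rev r)"
      unfolding cost_opt_def
    proof (rule cInf_eq_minimum)
      show "walk_cost G (rev r) \<in> walk_cost G ` {w. exploration_tour G s w}" using tour by blast
      fix x assume "x \<in> walk_cost G ` {w. exploration_tour G s w}"
      then show "walk_cost G (rev r) \<le> x" using lower r(7) by (fastforce simp: walk_cost_rev)
    qed
    then show ?thesis using run tour bs(1) by (intro exI[of _ "b # bs"]) auto
  qed
  show "\<exists>adv. length adv = nat \<lceil>log 2 (real (card (verts G)))\<rceil> + 1 \<and>
      (\<exists>w. completed_run explorer adv G s w \<and> exploration_tour G s w \<and> walk_cost G w = cost_opt G s)"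
  proof (cases "2 * sum ?c ?E - sum ?c ?C \<le> 2 * (sum ?c ?E - ?c e)")
    case True
    have fin: "finite (verts G)" by (simp add: V)
    have sub: "nbrs ?E j \<subseteq> verts G - {j}" using nbrs_subset[of j] V by simp
    have "hd ys \<in> nbrs ?E j" by (simp add: nbrs_def E)
    then obtain k where k: "k < card (nbrs ?E j)" "enumeration (nbrs ?E j) ! k = hd ys"
      using ex_enumeration_index finite_subset[OF sub] fin by (metis finite_Diff)
    have "card (nbrs ?E j) \<le> card (verts G)" using sub fin by (intro card_mono) auto
    then have "k < card (verts G)" using k(1) by simp
    moreover obtain r where "follows (cycle_act k (nbrs ?E)) s r" "cycle_act k (nbrs ?E) r = None"
      "hd r = s" "last r = s" "path_edges r \<subseteq> ?E" "set r = set xs \<union> set ys"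
      "path_cost ?c r \<le> 2 * sum ?c ?E - sum ?c ?C"
      using cycle_exploration[where c = ?c, OF k(2) s c] by blast
    ultimately show ?thesis
      using True by (intro *[of k True "cycle_act k (nbrs ?E)" r]) (auto simp: explorer_eq M_def)
  next
    case False
    obtain r where r: "follows (tree_act (\<lambda>_ f. f = e) (nbrs ?E)) s r"
      "tree_act (\<lambda>_ f. f = e) (nbrs ?E) r = None"
      "hd r = s" "last r = s" "path_edges r \<subseteq> ?E" "set r = set xs \<union> set ys"
      "path_cost ?c r \<le> 2 * (sum ?c ?E - ?c e)"
      using tree_exploration[where c = ?c, OF e(1) s c] by blast
    have "nbrs ?E v \<subseteq> verts G" for v using nbrs_subset[of v] V by auto
    then obtain k where k: "k < card (verts G)"
      "\<And>q p. r = p @ q \<Longrightarrow> skipped (\<lambda>S _. card S = k) (nbrs ?E) q = skipped (\<lambda>_ f. f = e) (nbrs ?E) q"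
      using skip_by_counting[OF r(1), of "verts G"] r(6) V by auto
    let ?act = "tree_act (\<lambda>S _. card S = k) (nbrs ?E)"
    \<comment> \<open>The counting strategy is compared with the ideal one only on the histories
      along \<open>r\<close>, which is all that a deterministic run depends on.\<close>
    have act: "?act q = tree_act (\<lambda>_ f. f = e) (nbrs ?E) q" if "r = p @ q" for p q
      using k(2)[OF that] by (simp add: tree_act_def)
    have "follows ?act s r" using follows_cong[OF r(1)] act by metis
    moreover have "?act r = None" using act[of "[]" r] r(2) by simp
    ultimately show ?thesis
      using False k(1) r(3-7) by (intro *[of k False ?act r]) (auto simp: explorer_eq M_def)
  qed
qed

end
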